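(* Let $q$ be a power of an odd prime $p$. Then the power graph of $\mathrm{PSL}(3,q)$ is not a chordal graph.
   Context: The power graph $\mathcal{P}(G)$ of a group $G$ is the undirected simple graph with vertex set $G$ in which distinct $a,b$ are adjacent iff $a=b^m$ or $b=a^n$ for some positive integers $m,n$. A graph is chordal if it has no induced cycle of length $4$ or more. *)

theory Defs
  imports
    "HOL-Analysis.Determinants"
    "HOL-Library.Numeral_Type"
    "HOL-Computational_Algebra.Primes"
    "HOL-Algebra.Coset"
    "Graph_Theory.Pair_Digraph"
begin

section \<open>Special and projective special linear groups\<close>

definition SL :: "('a::field ^ 'n ^ 'n) monoid" where
  "SL = \<lparr>carrier = {A. det A = 1}, mult = (**), one = mat 1\<rparr>"

definition group_center :: "('g, 'h) monoid_scheme \<Rightarrow> 'g set" where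
  "group_center G = {z \<in> carrier G. \<forall>x \<in> carrier G. z \<otimes>\<^bsub>G\<^esub> x = x \<otimes>\<^bsub>G\<^esub> z}"

definition PSL :: "('a::field ^ 'n ^ 'n) set monoid" where
  "PSL = SL Mod group_center SL"

lemma group_SL: "group (SL :: ('a::field ^ 'n ^ 'n) monoid)"
proof (rule groupI)
  fix A :: "'a ^ 'n ^ 'n"
  assume "A \<in> carrier SL"
  then have A: "det A = 1" by (simp add: SL_def)
  then obtain B where B: "B ** A = mat 1"
    using invertible_det_nz[of A] by (auto simp: invertible_def)
  have "det B * det A = 1"
    using B by (metis det_mul det_I)
  with A B show "\<exists>B\<in>carrier SL. B \<otimes>\<^bsub>SL\<^esub> A = \<one>\<^bsub>SL\<^esub>"
    by (auto simp: SL_def)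
qed (auto simp: SL_def det_mul matrix_mul_assoc)

lemma normal_group_center:
  assumes "group G" shows "group_center G \<lhd> G"
proof -
  interpret group G by fact
  have comm_inv: "inv\<^bsub>G\<^esub> a \<otimes>\<^bsub>G\<^esub> x = x \<otimes>\<^bsub>G\<^esub> inv\<^bsub>G\<^esub> a"
    if "a \<in> carrier G" "x \<in> carrier G" "a \<otimes>\<^bsub>G\<^esub> x = x \<otimes>\<^bsub>G\<^esub> a" for a x
  proof -
    have "inv\<^bsub>G\<^esub> a \<otimes>\<^bsub>G\<^esub> x = inv\<^bsub>G\<^esub> a \<otimes>\<^bsub>G\<^esub> (x \<otimes>\<^bsub>G\<^esub> a) \<otimes>\<^bsub>G\<^esub> inv\<^bsub>G\<^esub> a"
      using that(1,2) by (simp add: m_assoc)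
    also have "\<dots> = inv\<^bsub>G\<^esub> a \<otimes>\<^bsub>G\<^esub> (a \<otimes>\<^bsub>G\<^esub> x) \<otimes>\<^bsub>G\<^esub> inv\<^bsub>G\<^esub> a"
      by (simp only: that(3))
    also have "\<dots> = x \<otimes>\<^bsub>G\<^esub> inv\<^bsub>G\<^esub> a"
      using that(1,2) by (simp add: m_assoc[symmetric])
    finally show ?thesis .
  qed
  have comm_mult: "(a \<otimes>\<^bsub>G\<^esub> b) \<otimes>\<^bsub>G\<^esub> x = x \<otimes>\<^bsub>G\<^esub> (a \<otimes>\<^bsub>G\<^esub> b)"
    if c: "a \<in> carrier G" "b \<in> carrier G" "x \<in> carrier G"
      and ax: "a \<otimes>\<^bsub>G\<^esub> x = x \<otimes>\<^bsub>G\<^esub> a" and bx: "b \<otimes>\<^bsub>G\<^esub> x = x \<otimes>\<^bsub>G\<^esub> b" for a b x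
  proof -
    have "(a \<otimes>\<^bsub>G\<^esub> b) \<otimes>\<^bsub>G\<^esub> x = a \<otimes>\<^bsub>G\<^esub> (x \<otimes>\<^bsub>G\<^esub> b)" using c by (simp only: m_assoc bx)
    also have "\<dots> = (x \<otimes>\<^bsub>G\<^esub> a) \<otimes>\<^bsub>G\<^esub> b" using c by (simp only: m_assoc[symmetric] ax)
    also have "\<dots> = x \<otimes>\<^bsub>G\<^esub> (a \<otimes>\<^bsub>G\<^esub> b)" using c by (simp only: m_assoc)
    finally show ?thesis .
  qed
  have sub: "subgroup (group_center G) G"
  proof (rule subgroupI)
    show "group_center G \<subseteq> carrier G" by (auto simp: group_center_def)
    have "\<one>\<^bsub>G\<^esub> \<in> group_center G" by (simp add: group_center_def)
    then show "group_center G \<noteq> {}" by blast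
    show "inv\<^bsub>G\<^esub> a \<in> group_center G" if "a \<in> group_center G" for a
      using that unfolding group_center_def by (blast intro: comm_inv)
    show "a \<otimes>\<^bsub>G\<^esub> b \<in> group_center G" if "a \<in> group_center G" "b \<in> group_center G" for a b
      using that unfolding group_center_def by (blast intro: comm_mult)
  qed
  show ?thesis
  proof (rule normalI[OF sub], intro ballI)
    fix x assume x: "x \<in> carrier G"
    have "z \<otimes>\<^bsub>G\<^esub> x = x \<otimes>\<^bsub>G\<^esub> z" if "z \<in> group_center G" for z
      using that x unfolding group_center_def by blast
    then show "group_center G #>\<^bsub>G\<^esub> x = x <#\<^bsub>G\<^esub> group_center G"
      unfolding r_coset_def l_coset_def by (intro SUP_cong) simp_all
  qed
qed

lemma group_PSL: "group (PSL :: ('a::field ^ 'n ^ 'n) set monoid)"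
  unfolding PSL_def by (intro normal.factorgroup_is_group normal_group_center group_SL)


section \<open>Power graphs and chordal graphs\<close>

text \<open>
  As in the library, undirected simple graphs are represented as symmetric loop-free digraphs
  without parallel arcs: an edge between \<open>a\<close> and \<open>b\<close> is the pair of arcs \<open>(a, b)\<close> and \<open>(b, a)\<close>.
\<close>

definition power_graph :: "('g, 'h) monoid_scheme \<Rightarrow> 'g pair_pre_digraph" where
  "power_graph G = \<lparr>
     pverts = carrier G,
     parcs = {(a, b). a \<in> carrier G \<and> b \<in> carrier G \<and> a \<noteq> b \<and>
       ((\<exists>m::nat. m > 0 \<and> a = b [^]\<^bsub>G\<^esub> m) \<or> (\<exists>n::nat. n > 0 \<and> b = a [^]\<^bsub>G\<^esub> n))}\<rparr>"

text \<open>
  The vertices listed in \<open>vs\<close>, in cyclic order, induce a cycle of length \<open>length vs\<close>: consecutive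
  vertices (indices modulo the length) are adjacent, and no other two are.
\<close>

definition induced_cycle :: "'v pair_pre_digraph \<Rightarrow> 'v list \<Rightarrow> bool" where
  "induced_cycle \<Gamma> vs \<longleftrightarrow>
     3 \<le> length vs \<and> distinct vs \<and> set vs \<subseteq> pverts \<Gamma> \<and>
     (\<forall>i < length vs. \<forall>j < length vs.
        (vs ! i, vs ! j) \<in> parcs \<Gamma> \<longleftrightarrow>
        j = Suc i mod length vs \<or> i = Suc j mod length vs)"

definition chordal :: "'v pair_pre_digraph \<Rightarrow> bool" where
  "chordal \<Gamma> \<longleftrightarrow> \<not> (\<exists>vs. induced_cycle \<Gamma> vs \<and> 4 \<le> length vs)"

lemma pair_graph_power_graph:
  assumes "finite (carrier G)"
  shows "pair_graph (power_graph G)"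
proof
  show "finite (parcs (power_graph G))"
    by (rule finite_subset[of _ "carrier G \<times> carrier G"])
      (use assms in \<open>auto simp: power_graph_def\<close>)
  show "symmetric (with_proj (power_graph G))"
    by (auto simp: symmetric_def sym_def arcs_ends_def arc_to_ends_def power_graph_def)
qed (use assms in \<open>auto simp: power_graph_def\<close>)

end

theory Submission
  imports Defs "HOL-Number_Theory.Residues"
begin

text \<open>
  The power graph contains an induced cycle of length 12. Suppose that \<open>x\<^sub>1, x\<^sub>2, x\<^sub>3\<close> have order 2,
  that \<open>y\<^sub>1, y\<^sub>2, y\<^sub>3\<close> have odd order, that \<open>x\<^sub>i\<close> commutes with \<open>y\<^sub>j\<close> whenever \<open>i \<noteq> j\<close>, and
  that the cyclic groups generated by the \<open>x\<^sub>i\<close> do not contain one another, and likewise for the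
  \<open>y\<^sub>j\<close>. The pairs \<open>(i, j)\<close> with \<open>i \<noteq> j\<close> are the edges of a hexagon joining the \<open>x\<close>'s to the
  \<open>y\<close>'s. Both \<open>x\<^sub>i\<close> and \<open>y\<^sub>j\<close> are powers of \<open>x\<^sub>i y\<^sub>j\<close>, because their orders are coprime, so
  placing \<open>x\<^sub>i y\<^sub>j\<close> on the edge \<open>(i, j)\<close> turns the hexagon into a closed walk of length 12 in the
  power graph. It has no chords: if \<open>u\<close> is a power of \<open>v\<close>, then the \<open>x\<close>-part of \<open>u\<close> is a power
  of that of \<open>v\<close>, and similarly for the \<open>y\<close>-parts (\<open>vertex_eq_pow_iff\<close>).

  In \<open>SL(3, q)\<close> such elements come from the projective plane. Let \<open>L\<close> be the line with equation
  \<open>v\<^sub>1 + v\<^sub>2 + v\<^sub>3 = 0\<close>, and let \<open>x\<^sub>i\<close> be the involution fixing the point \<open>e\<^sub>i\<close> and acting as \<open>-1\<close>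
  on \<open>L\<close>. Let \<open>y\<^sub>k\<close> be a transvection whose axis is the side \<open>e\<^sub>i e\<^sub>j\<close> of the coordinate triangle
  opposite \<open>e\<^sub>k\<close> and whose centre is the point where that side meets \<open>L\<close>. If \<open>i \<noteq> k\<close>,
  then \<open>x\<^sub>i\<close> preserves the centre and the axis of \<open>y\<^sub>k\<close>, and it acts as \<open>-1\<close> both on the centre
  and on the quotient of the space by the axis; this makes it commute with \<open>y\<^sub>k\<close>.

  The passage to \<open>PSL(3, q)\<close> rests on \<open>commute_if_coset_eq_pow\<close>: non-commuting elements of a group
  remain independent modulo the centre. Thus it is enough that no two of the \<open>x\<^sub>i\<close> commute, and
  no two of the \<open>y\<^sub>j\<close>, and the centre never has to be computed.
\<close>

section \<open>A chordless cycle from two families of coprime orders\<close>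

lemma (in monoid) nat_pow_mod:
  fixes r n :: nat
  assumes "x \<in> carrier G" "x [^] r = \<one>"
  shows "x [^] n = x [^] (n mod r)"
proof -
  have "x [^] n = x [^] (r * (n div r) + n mod r)" by simp
  also have "\<dots> = (x [^] r) [^] (n div r) \<otimes> x [^] (n mod r)"
    using assms(1) by (simp only: nat_pow_mult nat_pow_pow nat_pow_closed)
  finally show ?thesis using assms by simp
qed

lemma (in monoid) nat_pow_cong:
  fixes r m n :: nat
  assumes "x \<in> carrier G" "x [^] r = \<one>" "[m = n] (mod r)"
  shows "x [^] m = x [^] n"
  using assms nat_pow_mod[of x r m] nat_pow_mod[of x r n] by (simp add: cong_def)

text \<open>
  The independence conditions include \<open>m = 0\<close>; hence, as soon as the index type has two elements,
  no \<open>x i\<close> or \<open>y i\<close> is the identity.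
\<close>

locale coprime_families = group G for G (structure) +
  fixes x y :: "'i \<Rightarrow> 'a" and r s :: nat
  assumes x_closed [simp]: "x i \<in> carrier G" and y_closed [simp]: "y i \<in> carrier G"
    and x_pow: "x i [^] r = \<one>" and y_pow: "y i [^] s = \<one>"
    and coprime: "coprime r s" and r_pos: "r > 0" and s_pos: "s > 0"
    and commute: "i \<noteq> j \<Longrightarrow> x i \<otimes> y j = y j \<otimes> x i"
    and x_indep: "i \<noteq> j \<Longrightarrow> x i \<noteq> x j [^] (m::nat)"
    and y_indep: "i \<noteq> j \<Longrightarrow> y i \<noteq> y j [^] (m::nat)"
begin

text \<open>
  A vertex of the cycle is labelled by an optional \<open>x\<close>-index and an optional \<open>y\<close>-index, so that
  \<open>x\<^sub>i\<close>, \<open>y\<^sub>j\<close> and \<open>x\<^sub>i y\<^sub>j\<close> are treated alike: a missing index stands for the factor \<open>\<one>\<close>.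
\<close>

definition x_part :: "'i option \<Rightarrow> 'a" where
  "x_part u = (case u of None \<Rightarrow> \<one> | Some i \<Rightarrow> x i)"

definition y_part :: "'i option \<Rightarrow> 'a" where
  "y_part u = (case u of None \<Rightarrow> \<one> | Some i \<Rightarrow> y i)"

definition vertex :: "'i option \<times> 'i option \<Rightarrow> 'a" where
  "vertex u = x_part (fst u) \<otimes> y_part (snd u)"

text \<open>The labels whose two factors are known to commute.\<close>

definition valid :: "'i option \<times> 'i option \<Rightarrow> bool" where
  "valid u \<longleftrightarrow> fst u = None \<or> fst u \<noteq> snd u"

definition below :: "'i option \<times> 'i option \<Rightarrow> 'i option \<times> 'i option \<Rightarrow> bool" where
  "below u v \<longleftrightarrow> (fst u = None \<or> fst u = fst v) \<and> (snd u = None \<or> snd u = snd v)"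

lemma part_None: "x_part None = \<one>" "y_part None = \<one>"
  by (simp_all add: x_part_def y_part_def)

lemma part_closed [simp]: "x_part u \<in> carrier G" "y_part u \<in> carrier G"
  by (auto simp: x_part_def y_part_def split: option.split)

lemma vertex_closed [simp]: "vertex u \<in> carrier G"
  by (simp add: vertex_def)

lemma part_pow: "x_part u [^] r = \<one>" "y_part u [^] s = \<one>"
  by (auto simp: x_part_def y_part_def x_pow y_pow split: option.split)

lemma x_part_eq_powD:
  assumes ne: "\<exists>i j::'i. i \<noteq> j" and eq: "x_part u = x_part v [^] (m::nat)"
  shows "u = None \<or> u = v"
proof (cases u)
  case (Some i)
  obtain j where j: "i \<noteq> j" using ne by metis
  show ?thesis
  proof (cases v)
    case None
    then show ?thesis using eq Some x_indep[OF j, of 0] by (simp add: x_part_def)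
  next
    case (Some k)
    then show ?thesis using eq \<open>u = Some i\<close> x_indep[of i k m] by (auto simp: x_part_def)
  qed
qed simp

lemma y_part_eq_powD:
  assumes ne: "\<exists>i j::'i. i \<noteq> j" and eq: "y_part u = y_part v [^] (m::nat)"
  shows "u = None \<or> u = v"
proof (cases u)
  case (Some i)
  obtain j where j: "i \<noteq> j" using ne by metis
  show ?thesis
  proof (cases v)
    case None
    then show ?thesis using eq Some y_indep[OF j, of 0] by (simp add: y_part_def)
  next
    case (Some k)
    then show ?thesis using eq \<open>u = Some i\<close> y_indep[of i k m] by (auto simp: y_part_def)
  qed
qed simp

lemma vertex_pow:
  assumes "valid u"
  shows "vertex u [^] (n::nat) = x_part (fst u) [^] n \<otimes> y_part (snd u) [^] n"
proof -
  have "x_part (fst u) \<otimes> y_part (snd u) = y_part (snd u) \<otimes> x_part (fst u)"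
    using assms commute by (auto simp: valid_def x_part_def y_part_def split: option.splits)
  then show ?thesis unfolding vertex_def by (rule pow_mult_distrib) simp_all
qed

text \<open>
  By the Chinese remainder theorem there are exponents \<open>e\<close> and \<open>f\<close> whose power maps project every
  vertex onto its \<open>x\<close>-part and its \<open>y\<close>-part. Power maps commute with each other, so a relation
  \<open>u = v\<^sup>m\<close> passes to both parts, where independence forces the labels to agree. Conversely,
  sums of \<open>e\<close> and \<open>f\<close> produce every vertex obtained from \<open>v\<close> by deleting factors.
\<close>

lemma vertex_eq_pow_iff:
  assumes ne: "\<exists>i j::'i. i \<noteq> j" and u: "valid u" and v: "valid v"
  shows "(\<exists>m::nat. m > 0 \<and> vertex u = vertex v [^] m) \<longleftrightarrow> below u v"
proof -
  obtain e where e: "[e = 1] (mod r)" "[e = 0] (mod s)"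
    using binary_chinese_remainder_nat[OF coprime] by blast
  obtain f where f: "[f = 0] (mod r)" "[f = 1] (mod s)"
    using binary_chinese_remainder_nat[OF coprime] by blast
  have x_e: "x_part w [^] e = x_part w" and y_e: "y_part w [^] e = \<one>"
    and x_f: "x_part w [^] f = \<one>" and y_f: "y_part w [^] f = y_part w" for w
    using nat_pow_cong[OF _ part_pow(1) e(1), of w] nat_pow_cong[OF _ part_pow(2) e(2), of w]
      nat_pow_cong[OF _ part_pow(1) f(1), of w] nat_pow_cong[OF _ part_pow(2) f(2), of w]
    by simp_all
  have proj: "vertex w [^] e = x_part (fst w)" "vertex w [^] f = y_part (snd w)" if "valid w" for w
    using that by (simp_all add: vertex_pow x_e y_e x_f y_f)
  show ?thesis
  proof
    assume "\<exists>m::nat. m > 0 \<and> vertex u = vertex v [^] m"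
    then obtain m :: nat where m: "vertex u = vertex v [^] m" by blast
    have swap: "vertex u [^] n = (vertex v [^] n) [^] m" for n :: nat
      using m by (simp add: nat_pow_pow mult.commute)
    have "x_part (fst u) = x_part (fst v) [^] m" "y_part (snd u) = y_part (snd v) [^] m"
      using swap[of e] swap[of f] by (simp_all only: proj[OF u] proj[OF v])
    then show "below u v"
      unfolding below_def using x_part_eq_powD[OF ne] y_part_eq_powD[OF ne] by blast
  next
    assume b: "below u v"
    \<comment> \<open>The summand \<open>r * s\<close> does not change the power; it makes the exponent positive.\<close>
    define n where "n = (if fst u = None then 0 else e) + (if snd u = None then 0 else f) + r * s"
    have "vertex v [^] (r * s) = \<one>"
      using v nat_pow_cong[OF _ part_pow(1), where m = "r * s" and n = 0]
        nat_pow_cong[OF _ part_pow(2), where m = "r * s" and n = 0]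
      by (simp add: vertex_pow cong_def)
    then have "vertex v [^] n = (if fst u = None then \<one> else vertex v [^] e)
        \<otimes> (if snd u = None then \<one> else vertex v [^] f)"
      by (simp add: n_def nat_pow_mult[symmetric])
    also have "\<dots> = vertex u"
      unfolding proj[OF v] unfolding vertex_def using b by (auto simp: below_def part_None)
    finally have "vertex u = vertex v [^] n" by simp
    moreover have "n > 0" using r_pos s_pos by (simp add: n_def)
    ultimately show "\<exists>m::nat. m > 0 \<and> vertex u = vertex v [^] m" by blast
  qed
qed

lemma vertex_inj:
  assumes ne: "\<exists>i j::'i. i \<noteq> j" and u: "valid u" and v: "valid v" and eq: "vertex u = vertex v"
  shows "u = v"
proof -
  have "vertex u = vertex v [^] (1::nat)" "vertex v = vertex u [^] (1::nat)"
    using eq by simp_all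
  then have "below u v" "below v u"
    using vertex_eq_pow_iff[OF ne u v] vertex_eq_pow_iff[OF ne v u] zero_less_one by blast+
  then show ?thesis by (auto simp: below_def prod_eq_iff)
qed

lemma arc_iff:
  assumes ne: "\<exists>i j::'i. i \<noteq> j" and u: "valid u" and v: "valid v"
  shows "(vertex u, vertex v) \<in> parcs (power_graph G) \<longleftrightarrow> u \<noteq> v \<and> (below u v \<or> below v u)"
  using vertex_eq_pow_iff[OF ne u v] vertex_eq_pow_iff[OF ne v u] vertex_inj[OF ne u v]
  by (auto simp: power_graph_def)

text \<open>
  The cycle walks around the hexagon \<open>x\<^sub>a, y\<^sub>b, x\<^sub>c, y\<^sub>a, x\<^sub>b, y\<^sub>c\<close>, whose consecutive members carry
  different indices and therefore commute, and visits between two of them their product.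
  Since adjacency can be read off from the labels, its chordlessness is a finite check.
\<close>

lemma not_chordal_power_graph:
  assumes dist: "distinct [a, b, c :: 'i]"
  shows "\<not> chordal (power_graph G)"
proof -
  define L where "L =
    [(Some a, None), (Some a, Some b), (None, Some b), (Some c, Some b),
     (Some c, None), (Some c, Some a), (None, Some a), (Some b, Some a),
     (Some b, None), (Some b, Some c), (None, Some c), (Some a, Some c)]"
  have abc: "a \<noteq> b" "b \<noteq> a" "a \<noteq> c" "c \<noteq> a" "b \<noteq> c" "c \<noteq> b" using dist by auto
  then have ne: "\<exists>i j::'i. i \<noteq> j" by blast
  have valid: "valid u" if "u \<in> set L" for u
    using that abc by (auto simp: L_def valid_def)
  have len: "length L = 12" by (simp add: L_def)
  have cycle: "\<forall>i<12. \<forall>j<12. L ! i \<noteq> L ! j \<and> (below (L ! i) (L ! j) \<or> below (L ! j) (L ! i)) \<longleftrightarrow>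
      j = Suc i mod 12 \<or> i = Suc j mod 12"
  proof -
    have nths: "L ! 0 = (Some a, None)" "L ! 1 = (Some a, Some b)" "L ! 2 = (None, Some b)"
      "L ! 3 = (Some c, Some b)" "L ! 4 = (Some c, None)" "L ! 5 = (Some c, Some a)"
      "L ! 6 = (None, Some a)" "L ! 7 = (Some b, Some a)" "L ! 8 = (Some b, None)"
      "L ! 9 = (Some b, Some c)" "L ! 10 = (None, Some c)" "L ! 11 = (Some a, Some c)"
      by (simp_all add: L_def)
    have all_less_12: "(\<forall>i<12. P i) \<longleftrightarrow> P 0 \<and> P 1 \<and> P 2 \<and> P 3 \<and> P 4 \<and> P 5 \<and> P 6 \<and> P 7 \<and>
        P 8 \<and> P 9 \<and> P 10 \<and> P 11" for P :: "nat \<Rightarrow> bool"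
      by (simp add: eval_nat_numeral All_less_Suc conj_ac)
    show ?thesis
      unfolding all_less_12 nths by (simp add: below_def abc)
  qed
  have "induced_cycle (power_graph G) (map vertex L)"
    unfolding induced_cycle_def
  proof (intro conjI)
    have "inj_on vertex (set L)" by (rule inj_onI) (rule vertex_inj[OF ne valid valid])
    moreover have "distinct L" using abc by (simp add: L_def)
    ultimately show "distinct (map vertex L)" by (simp add: distinct_map)
    show "set (map vertex L) \<subseteq> pverts (power_graph G)" by (auto simp: power_graph_def)
    show "\<forall>i<length (map vertex L). \<forall>j<length (map vertex L).
        (map vertex L ! i, map vertex L ! j) \<in> parcs (power_graph G) \<longleftrightarrow>
        j = Suc i mod length (map vertex L) \<or> i = Suc j mod length (map vertex L)"
      using cycle by (simp add: len arc_iff[OF ne] valid)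
  qed (simp add: len)
  then show ?thesis using len by (auto simp: chordal_def intro!: exI[of _ "map vertex L"])
qed

end

section \<open>Passing to the quotient by the centre\<close>

text \<open>
  If the coset of \<open>a\<close> is a power of the coset of \<open>b\<close>, then \<open>a = z b\<^sup>m\<close> with \<open>z\<close> central, and both
  factors commute with \<open>b\<close>.
\<close>

lemma commute_if_coset_eq_pow:
  fixes m :: nat
  assumes "group G" and a: "a \<in> carrier G" and b: "b \<in> carrier G"
    and eq: "group_center G #>\<^bsub>G\<^esub> a = (group_center G #>\<^bsub>G\<^esub> b) [^]\<^bsub>G Mod group_center G\<^esub> m"
  shows "a \<otimes>\<^bsub>G\<^esub> b = b \<otimes>\<^bsub>G\<^esub> a"
proof -
  interpret group G by fact
  interpret Z: normal "group_center G" G by (rule normal_group_center) fact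
  have "group_center G #>\<^bsub>G\<^esub> a = group_center G #>\<^bsub>G\<^esub> (b [^]\<^bsub>G\<^esub> m)"
    using eq hom_nat_pow[OF Z.r_coset_hom_Mod b is_group Z.factorgroup_is_group] by simp
  then have "a \<in> group_center G #>\<^bsub>G\<^esub> (b [^]\<^bsub>G\<^esub> m)"
    using a rcos_self Z.subgroup_axioms by blast
  then obtain z where z: "z \<in> group_center G" and az: "a = z \<otimes>\<^bsub>G\<^esub> b [^]\<^bsub>G\<^esub> m"
    unfolding r_coset_def by blast
  have zc: "z \<in> carrier G" and zb: "z \<otimes>\<^bsub>G\<^esub> b = b \<otimes>\<^bsub>G\<^esub> z"
    using z b unfolding group_center_def by blast+
  have "b [^]\<^bsub>G\<^esub> m \<otimes>\<^bsub>G\<^esub> b = b \<otimes>\<^bsub>G\<^esub> b [^]\<^bsub>G\<^esub> m"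
    using b nat_pow_Suc2[OF b, of m] by simp
  then have "a \<otimes>\<^bsub>G\<^esub> b = (z \<otimes>\<^bsub>G\<^esub> b) \<otimes>\<^bsub>G\<^esub> b [^]\<^bsub>G\<^esub> m"
    using zc b by (simp add: az m_assoc)
  also have "\<dots> = b \<otimes>\<^bsub>G\<^esub> a"
    using zc b by (simp add: az zb m_assoc)
  finally show ?thesis .
qed

lemma coprime_families_center_quotient:
  fixes x y :: "'i \<Rightarrow> 'g" and r s :: nat
  assumes "group G"
    and x: "\<And>i. x i \<in> carrier G" and y: "\<And>i. y i \<in> carrier G"
    and x_pow: "\<And>i. x i [^]\<^bsub>G\<^esub> r = \<one>\<^bsub>G\<^esub>" and y_pow: "\<And>i. y i [^]\<^bsub>G\<^esub> s = \<one>\<^bsub>G\<^esub>"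
    and "coprime r s" "r > 0" "s > 0"
    and commute: "\<And>i j. i \<noteq> j \<Longrightarrow> x i \<otimes>\<^bsub>G\<^esub> y j = y j \<otimes>\<^bsub>G\<^esub> x i"
    and x_ncomm: "\<And>i j. i \<noteq> j \<Longrightarrow> x i \<otimes>\<^bsub>G\<^esub> x j \<noteq> x j \<otimes>\<^bsub>G\<^esub> x i"
    and y_ncomm: "\<And>i j. i \<noteq> j \<Longrightarrow> y i \<otimes>\<^bsub>G\<^esub> y j \<noteq> y j \<otimes>\<^bsub>G\<^esub> y i"
  shows "coprime_families (G Mod group_center G)
    (\<lambda>i. group_center G #>\<^bsub>G\<^esub> x i) (\<lambda>i. group_center G #>\<^bsub>G\<^esub> y i) r s"
proof -
  interpret group G by fact
  interpret Z: normal "group_center G" G by (rule normal_group_center) fact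
  interpret quot: group_hom G "G Mod group_center G" "\<lambda>a. group_center G #>\<^bsub>G\<^esub> a"
    by (intro group_hom.intro group_hom_axioms.intro is_group Z.factorgroup_is_group
        Z.r_coset_hom_Mod)
  show ?thesis
  proof unfold_locales
    fix i j :: 'i and m :: nat
    show "group_center G #>\<^bsub>G\<^esub> x i \<in> carrier (G Mod group_center G)"
      "group_center G #>\<^bsub>G\<^esub> y i \<in> carrier (G Mod group_center G)"
      by (auto intro: quot.hom_closed x y)
    show "(group_center G #>\<^bsub>G\<^esub> x i) [^]\<^bsub>G Mod group_center G\<^esub> r = \<one>\<^bsub>G Mod group_center G\<^esub>"
      using quot.hom_nat_pow[OF x, of i r] by (simp only: x_pow quot.hom_one)
    show "(group_center G #>\<^bsub>G\<^esub> y i) [^]\<^bsub>G Mod group_center G\<^esub> s = \<one>\<^bsub>G Mod group_center G\<^esub>"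
      using quot.hom_nat_pow[OF y, of i s] by (simp only: y_pow quot.hom_one)
    assume "i \<noteq> j"
    then show "(group_center G #>\<^bsub>G\<^esub> x i) \<otimes>\<^bsub>G Mod group_center G\<^esub> (group_center G #>\<^bsub>G\<^esub> y j) =
        (group_center G #>\<^bsub>G\<^esub> y j) \<otimes>\<^bsub>G Mod group_center G\<^esub> (group_center G #>\<^bsub>G\<^esub> x i)"
      using quot.hom_mult[OF x y, of i j] quot.hom_mult[OF y x, of j i] commute by simp
    show "group_center G #>\<^bsub>G\<^esub> x i \<noteq> (group_center G #>\<^bsub>G\<^esub> x j) [^]\<^bsub>G Mod group_center G\<^esub> m"
      using commute_if_coset_eq_pow[OF is_group x x] x_ncomm \<open>i \<noteq> j\<close> by blast
    show "group_center G #>\<^bsub>G\<^esub> y i \<noteq> (group_center G #>\<^bsub>G\<^esub> y j) [^]\<^bsub>G Mod group_center G\<^esub> m"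
      using commute_if_coset_eq_pow[OF is_group y y] y_ncomm \<open>i \<noteq> j\<close> by blast
  qed (use assms in auto)
qed

section \<open>Involutions and transvections of three-dimensional space\<close>

text \<open>
  The map \<open>v \<mapsto> 2 (v\<^sub>1 + v\<^sub>2 + v\<^sub>3) e\<^sub>i - v\<close>: it fixes \<open>e\<^sub>i\<close> and negates the plane
  \<open>v\<^sub>1 + v\<^sub>2 + v\<^sub>3 = 0\<close>.
\<close>

definition involution :: "3 \<Rightarrow> 'a::field ^ 3 ^ 3" where
  "involution i = (\<chi> r c. (if r = i then 2 else 0) - (if r = c then 1 else 0))"

text \<open>
  The map \<open>v \<mapsto> v + t v\<^sub>k (e\<^sub>i - e\<^sub>j)\<close> with \<open>i = k + 1\<close> and \<open>j = k + 2\<close>; the index type has three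
  elements, so these sums are cyclic. The direction \<open>e\<^sub>i - e\<^sub>j\<close> lies in the plane negated by the
  involutions and in the axis \<open>v\<^sub>k = 0\<close>.
\<close>

definition transvection :: "3 \<Rightarrow> 'a \<Rightarrow> 'a::field ^ 3 ^ 3" where
  "transvection k t = (\<chi> r c. (if r = c then 1 else 0) +
     (if c = k then (if r = k + 1 then t else if r = k + 2 then - t else 0) else 0))"

lemmas matrix3_simps = involution_def transvection_def vec_eq_iff matrix_matrix_mult_def
  mat_def sum_3 forall_3

lemma involution_mult_self: "involution i ** involution i = (mat 1 :: 'a::field ^ 3 ^ 3)"
  using exhaust_3[of i] by (auto simp: matrix3_simps)

lemma det_involution: "det (involution i :: 'a::field ^ 3 ^ 3) = 1"
  using exhaust_3[of i] by (auto simp: det_3 matrix3_simps)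

lemma transvection_mult: "transvection k t ** transvection k u = transvection k (t + u)"
  using exhaust_3[of k] by (auto simp: matrix3_simps)

lemma transvection_0: "transvection k 0 = mat 1"
  by (auto simp: matrix3_simps)

lemma det_transvection: "det (transvection k t) = 1"
  using exhaust_3[of k] by (auto simp: det_3 matrix3_simps)

lemma involution_transvection_commute:
  "i \<noteq> k \<Longrightarrow> involution i ** transvection k t = transvection k t ** involution i"
  using exhaust_3[of i] exhaust_3[of k] by (auto simp: matrix3_simps)

text \<open>
  The difference of the two products, as a linear map, sends \<open>v\<close> to
  \<open>4 (v\<^sub>1 + v\<^sub>2 + v\<^sub>3) (e\<^sub>i - e\<^sub>j)\<close>.
\<close>

lemma involution_not_commute:
  assumes "(2::'a::field) \<noteq> 0" "i \<noteq> j"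
  shows "involution i ** involution j \<noteq> (involution j ** involution i :: 'a ^ 3 ^ 3)"
proof -
  have "(4::'a) \<noteq> 0" using assms(1) mult_eq_0_iff[of "2::'a" 2] by simp
  then show ?thesis
    using exhaust_3[of i] exhaust_3[of j] assms by (auto simp: matrix3_simps)
qed

text \<open>
  The centre \<open>e\<^sub>k - e\<^sub>j\<close> of one transvection, \<open>k\<close> being the third index, is off the axis \<open>v\<^sub>j = 0\<close>
  of the other.
\<close>

lemma transvection_not_commute:
  assumes "i \<noteq> j"
  shows "transvection i 1 ** transvection j 1 \<noteq>
    (transvection j 1 ** transvection i 1 :: 'a::field ^ 3 ^ 3)"
  using exhaust_3[of i] exhaust_3[of j] assms by (auto simp: matrix3_simps)

lemma transvection_pow:
  "transvection k 1 [^]\<^bsub>SL\<^esub> (n::nat) = (transvection k (of_nat n) :: 'a::field ^ 3 ^ 3)"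
  by (induction n) (simp_all add: nat_pow_def SL_def transvection_0 transvection_mult add.commute)

section \<open>The power graph of the projective special linear group\<close>

lemma of_nat_CARD_eq_0: "of_nat CARD('a) = (0::'a::{ring_1, finite})"
  by (simp add: of_nat_eq_0_iff_char_dvd CHAR_dvd_CARD)

theorem theorem5p8:
  fixes p k q :: nat
  assumes "prime p" and "odd p" and "k > 0" and "q = p ^ k"
    and "CARD('a::{field, finite}) = q"
  shows "\<not> chordal (power_graph (PSL :: ('a ^ 3 ^ 3) set monoid))"
proof -
  have "odd q" using assms by simp
  have q0: "of_nat q = (0::'a)" using of_nat_CARD_eq_0[where 'a='a] assms(5) by simp
  have two: "(2::'a) \<noteq> 0"
  proof
    assume "(2::'a) = 0"
    obtain l where "q = 2 * l + 1" using \<open>odd q\<close> by (rule oddE)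
    with q0 \<open>(2::'a) = 0\<close> show False by simp
  qed
  \<comment> \<open>The exponent \<open>q\<close> kills every transvection because \<open>q = 0\<close> in the field, and it is odd.\<close>
  have "coprime_families (SL Mod group_center SL)
      (\<lambda>i. group_center SL #>\<^bsub>SL\<^esub> (involution i :: 'a ^ 3 ^ 3))
      (\<lambda>i. group_center SL #>\<^bsub>SL\<^esub> transvection i 1) 2 q"
  proof (rule coprime_families_center_quotient)
    show "involution i [^]\<^bsub>SL\<^esub> (2::nat) = \<one>\<^bsub>(SL :: ('a ^ 3 ^ 3) monoid)\<^esub>" for i
      by (simp add: numeral_2_eq_2 nat_pow_def SL_def involution_mult_self)
    show "transvection i 1 [^]\<^bsub>SL\<^esub> q = \<one>\<^bsub>(SL :: ('a ^ 3 ^ 3) monoid)\<^esub>" for i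
      by (simp add: transvection_pow q0 transvection_0) (simp add: SL_def)
    show "coprime 2 q" "q > 0" using \<open>odd q\<close> by (auto intro: odd_pos)
  qed (auto simp: group_SL, auto simp: SL_def det_involution det_transvection
      involution_transvection_commute involution_not_commute[OF two] transvection_not_commute)
  then have "\<not> chordal (power_graph (SL Mod group_center (SL :: ('a ^ 3 ^ 3) monoid)))"
    by (rule coprime_families.not_chordal_power_graph[where a = 1 and b = 2 and c = 3]) simp
  then show ?thesis by (simp add: PSL_def)
qed

end
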